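(* Assume that the following statement (Conjecture C) is true: for every integer $k\ge2$, every permutation $(p_1,\dots,p_{k-1})$ of the set $\{\frac12,\frac1{2^2},\dots,\frac1{2^{k-1}}\}$, every $n\geq k+2$, and every optimal set of $n$-means $\{a_1,\dots,a_n\}$ with $a_1<\cdots<a_n$ for the measure $\sum_{j=1}^{k-1}p_j\delta_j+\sum_{j=k}^\infty\frac1{2^j}\delta_j$, one has $a_1=1,\ a_2=2,\ \dots,\ a_{n-3}=n-3$. Let $P=\frac1{2^3}\delta_1+\frac1{2^2}\delta_2+\frac12\delta_3+\sum_{j=4}^\infty\frac1{2^j}\delta_j$. Then for all $n\geq6$ the sets $$\{1,2,\dots,n-3,\,Av[n-2,n-1],\,Av[n,n+1],\,Av[n+2,\infty)\}$$ and $$\{1,2,\dots,n-3,\,n-2,\,Av[n-1,n],\,Av[n+1,\infty)\}$$ form the optimal sets of $n$-means for $P$, with quantization error $V_n(P)=\frac{2^{3-n}}{3}$.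
   Context: $\delta_x$ denotes the Dirac measure at $x\in\mathbb R$. For a Borel probability measure $P$ on $\mathbb R$ and a nonempty finite set $\alpha\subset\mathbb R$, the distortion error is $V(P;\alpha)=\int\min_{a\in\alpha}|x-a|^2\,dP(x)$. The $n$th quantization error is $V_n(P)=\inf\{V(P;\alpha):\alpha\subset\mathbb R,\ 1\le\mathrm{card}(\alpha)\le n\}$. An optimal set of $n$-means for $P$ is a set $\alpha$ with at most $n$ points for which this infimum is attained. With $p_m=P(\{m\})$ and $i\le\ell$ positive integers, $Av[i,\ell]=\frac{\sum_{m=i}^{\ell}p_m m}{\sum_{m=i}^{\ell}p_m}$ and $Av[i,\infty)=\frac{\sum_{m=i}^{\infty}p_m m}{\sum_{m=i}^{\infty}p_m}$. *)

theory Defs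
  imports "HOL-Probability.Probability"
begin

text \<open>The Borel measure with an atom of mass \<open>p j\<close> at each integer \<open>j \<ge> 1\<close>; the
  value \<open>p 0\<close> is irrelevant.\<close>

definition dirac_series :: "(nat \<Rightarrow> real) \<Rightarrow> real measure" where
  "dirac_series p = measure_of UNIV (sets borel)
     (\<lambda>A. \<Sum>j. ennreal (p (Suc j)) * emeasure (return borel (real (Suc j))) A)"

lemma space_dirac_series [simp]: "space (dirac_series p) = UNIV"
  by (simp add: dirac_series_def space_measure_of_conv)

lemma sets_dirac_series [simp, measurable_cong]: "sets (dirac_series p) = sets borel"
  unfolding dirac_series_def
  using sets.sigma_sets_eq[of "borel :: real measure"]
  by (simp add: sets_measure_of_conv)

lemma emeasure_dirac_series:
  assumes A: "A \<in> sets borel"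
  shows "emeasure (dirac_series p) A =
    (\<Sum>j. ennreal (p (Suc j)) * emeasure (return borel (real (Suc j))) A)"
proof (rule emeasure_measure_of[OF dirac_series_def])
  let ?\<mu> = "\<lambda>A. \<Sum>j. ennreal (p (Suc j)) * emeasure (return borel (real (Suc j))) A"
  show "sets borel \<subseteq> Pow (UNIV :: real set)"
    by simp
  show "A \<in> sets (dirac_series p)"
    using A by simp
  show "positive (sets (dirac_series p)) ?\<mu>"
    by (simp add: positive_def)
  show "countably_additive (sets (dirac_series p)) ?\<mu>"
  proof (rule countably_additiveI)
    fix B :: "nat \<Rightarrow> real set"
    assume B: "range B \<subseteq> sets (dirac_series p)" "disjoint_family B"
    let ?f = "\<lambda>i j. ennreal (p (Suc j)) * emeasure (return borel (real (Suc j))) (B i)"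
    have "(\<Sum>i. ?\<mu> (B i)) = (\<Sum>i. \<integral>\<^sup>+ j. ?f i j \<partial>count_space UNIV)"
      by (simp only: nn_integral_count_space_nat)
    also have "\<dots> = (\<integral>\<^sup>+ j. (\<Sum>i. ?f i j) \<partial>count_space UNIV)"
      by (rule nn_integral_suminf[symmetric]) simp
    also have "\<dots> = (\<Sum>j. \<Sum>i. ?f i j)"
      by (simp only: nn_integral_count_space_nat)
    also have "\<dots> = ?\<mu> (\<Union>i. B i)"
      using B by (simp del: emeasure_return add: suminf_emeasure)
    finally show "(\<Sum>i. ?\<mu> (B i)) = ?\<mu> (\<Union>i. B i)" .
  qed
qed

text \<open>The integral is taken in \<open>[0, \<infinity>]\<close>, so that a measure without
  second moment has distortion error \<open>\<infinity>\<close> rather than the default value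
  0 of a non-integrable Bochner integral.\<close>

definition distortion :: "real measure \<Rightarrow> real set \<Rightarrow> ennreal" where
  "distortion P \<alpha> = (\<integral>\<^sup>+ x. ennreal (Min ((\<lambda>a. \<bar>x - a\<bar>\<^sup>2) ` \<alpha>)) \<partial>P)"

definition quantization_error :: "nat \<Rightarrow> real measure \<Rightarrow> ennreal" where
  "quantization_error n P =
     (INF \<alpha>\<in>{\<alpha>. finite \<alpha> \<and> 1 \<le> card \<alpha> \<and> card \<alpha> \<le> n}. distortion P \<alpha>)"

definition optimal_n_means :: "nat \<Rightarrow> real measure \<Rightarrow> real set \<Rightarrow> bool" where
  "optimal_n_means n P \<alpha> \<longleftrightarrow>
     finite \<alpha> \<and> 1 \<le> card \<alpha> \<and> card \<alpha> \<le> n \<and> distortion P \<alpha> = quantization_error n P"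

definition Av :: "real measure \<Rightarrow> nat \<Rightarrow> nat \<Rightarrow> real" where
  "Av P i l = (\<Sum>m=i..l. measure P {real m} * real m) / (\<Sum>m=i..l. measure P {real m})"

definition Av_inf :: "real measure \<Rightarrow> nat \<Rightarrow> real" where
  "Av_inf P i =
     (\<Sum>\<^sub>\<infinity>m\<in>{i..}. measure P {real m} * real m) / (\<Sum>\<^sub>\<infinity>m\<in>{i..}. measure P {real m})"

end

theory Submission
  imports Defs "HOL-Real_Asymp.Real_Asymp"
begin

text \<open>Let \<open>a\<close> be the smallest point of a set \<open>\<alpha>\<close> of means. The integers
  \<open>\<ge> i\<close> nearest to \<open>a\<close> form an initial segment, so the error of \<open>\<alpha>\<close> on the
  integers \<open>\<ge> i\<close> is the cost of one block with centre \<open>a\<close> plus the error of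
  \<open>\<alpha> - {a}\<close> on a later tail. On a tail with weights \<open>2\<^sup>-\<^sup>j\<close>, this yields by
  recursion the minimal errors \<open>4/2\<^sup>i\<close>, \<open>(4/3)/2\<^sup>i\<close> and \<open>(2/3)/2\<^sup>i\<close> for one, two
  and three means. The last is attained twice, since for a first block of size 1 and one of
  size 2 the costs tie; with more means a singleton is the only optimal first block. The three
  permuted atoms must be isolated, because joining any of them to its successor
  costs more than \<open>1/24\<close>, an upper bound for the claimed error.\<close>

section \<open>Squared distance to the nearest mean\<close>

definition sqdist :: "real set \<Rightarrow> real \<Rightarrow> real" where
  "sqdist \<alpha> x = Min ((\<lambda>a. \<bar>x - a\<bar>\<^sup>2) ` \<alpha>)"

lemma sqdist_le: "finite \<alpha> \<Longrightarrow> a \<in> \<alpha> \<Longrightarrow> sqdist \<alpha> x \<le> (x - a)\<^sup>2"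
  by (simp add: sqdist_def)

lemma sqdist_nonneg: "finite \<alpha> \<Longrightarrow> \<alpha> \<noteq> {} \<Longrightarrow> 0 \<le> sqdist \<alpha> x"
  by (simp add: sqdist_def)

lemma sqdist_singleton [simp]: "sqdist {a} x = (x - a)\<^sup>2"
  by (simp add: sqdist_def)

lemma sqdist_insert:
  "finite \<beta> \<Longrightarrow> \<beta> \<noteq> {} \<Longrightarrow> sqdist (insert a \<beta>) x = min ((x - a)\<^sup>2) (sqdist \<beta> x)"
  by (simp add: sqdist_def)

lemma square_diff_le_iff:
  fixes a b x :: real
  assumes "a < b"
  shows "(x - a)\<^sup>2 \<le> (x - b)\<^sup>2 \<longleftrightarrow> 2 * x \<le> a + b"
proof -
  have "(x - b)\<^sup>2 - (x - a)\<^sup>2 = (b - a) * (a + b - 2 * x)"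
    by (simp add: power2_eq_square algebra_simps)
  moreover have "0 \<le> (b - a) * (a + b - 2 * x) \<longleftrightarrow> 0 \<le> a + b - 2 * x"
    using assms by (simp add: zero_le_mult_iff)
  ultimately show ?thesis by linarith
qed

text \<open>The weights \<open>1 / 2 ^ j\<close> have mass 2 and mean 1, and their second moment
  about this mean is 4.\<close>

lemma sums_geometric_square:
  "(\<lambda>j. (real j - x)\<^sup>2 / 2 ^ j) sums (4 + 2 * (x - 1)\<^sup>2)"
proof -
  \<comment> \<open>\<open>f j\<close> is the remainder of the series from index \<open>j\<close>
    on, so consecutive differences are the single terms.\<close>
  define f where "f j = (2 * (real j)\<^sup>2 + (4 - 4 * x) * real j + (2 * x\<^sup>2 + 6 - 4 * x)) / 2 ^ j" for j
  have "f \<longlonglongrightarrow> 0"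
    unfolding f_def by real_asymp
  from telescope_sums'[OF this] have "(\<lambda>j. f j - f (Suc j)) sums (f 0 - 0)" .
  moreover have "f j - f (Suc j) = (real j - x)\<^sup>2 / 2 ^ j" for j
    by (simp add: f_def power2_eq_square field_simps)
  moreover have "f 0 - 0 = 4 + 2 * (x - 1)\<^sup>2"
    by (simp add: f_def power2_eq_square algebra_simps)
  ultimately show ?thesis by simp
qed

section \<open>Weighted errors on the integers from a given one on\<close>

definition tail_error :: "(nat \<Rightarrow> real) \<Rightarrow> nat \<Rightarrow> real set \<Rightarrow> real" where
  "tail_error w i \<alpha> = (\<Sum>j. w (j + i) * sqdist \<alpha> (real (j + i)))"

text \<open>A finite second moment about every centre makes the series in \<open>tail_error\<close>
  converge, so \<open>suminf\<close> gives a genuine sum there.\<close>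

locale square_summable_weights =
  fixes w :: "nat \<Rightarrow> real"
  assumes weight_nonneg: "0 \<le> w j"
    and summable_weight_square: "summable (\<lambda>j. w j * (real j - x)\<^sup>2)"
begin

lemma summable_sqdist:
  assumes "finite \<alpha>" "\<alpha> \<noteq> {}"
  shows "summable (\<lambda>j. w (j + i) * sqdist \<alpha> (real (j + i)))"
proof -
  obtain a where "a \<in> \<alpha>" using assms by blast
  have "summable (\<lambda>j. w j * sqdist \<alpha> (real j))"
    by (rule summable_comparison_test'[OF summable_weight_square[of a], of 0])
      (use assms \<open>a \<in> \<alpha>\<close> in
        \<open>simp add: weight_nonneg sqdist_nonneg sqdist_le mult_left_mono\<close>)
  then show ?thesis
    by (subst summable_iff_shift)
qed

lemma tail_error_nonneg: "finite \<alpha> \<Longrightarrow> \<alpha> \<noteq> {} \<Longrightarrow> 0 \<le> tail_error w i \<alpha>"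
  unfolding tail_error_def
  by (intro suminf_nonneg summable_sqdist) (auto simp: weight_nonneg sqdist_nonneg)

lemma tail_error_split:
  assumes "finite \<alpha>" "\<alpha> \<noteq> {}" "i \<le> l"
  shows "tail_error w i \<alpha> = (\<Sum>j=i..<l. w j * sqdist \<alpha> (real j)) + tail_error w l \<alpha>"
proof -
  obtain k where l: "l = i + k" using \<open>i \<le> l\<close> le_Suc_ex by blast
  have "(\<Sum>j=i..<l. w j * sqdist \<alpha> (real j)) = (\<Sum>j<k. w (j + i) * sqdist \<alpha> (real (j + i)))"
    using sum.shift_bounds_nat_ivl[of "\<lambda>j. w j * sqdist \<alpha> (real j)" 0 i k]
    by (simp add: l add.commute atLeast0LessThan)
  then show ?thesis
    unfolding tail_error_def l
    using suminf_split_initial_segment[OF summable_sqdist[OF assms(1,2), of i], of k]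
    by (simp add: algebra_simps)
qed

text \<open>Assigning each integer to some mean, not necessarily the nearest, can only increase the
  error. This bounds the error of the candidate sets from above.\<close>

lemma tail_error_insert_le:
  assumes "finite \<beta>" "\<beta> \<noteq> {}" "i \<le> l"
  shows "tail_error w i (insert a \<beta>) \<le> (\<Sum>j=i..<l. w j * (real j - a)\<^sup>2) + tail_error w l \<beta>"
proof -
  have "(\<Sum>j=i..<l. w j * sqdist (insert a \<beta>) (real j)) \<le> (\<Sum>j=i..<l. w j * (real j - a)\<^sup>2)"
    using assms by (intro sum_mono mult_left_mono sqdist_le) (auto simp: weight_nonneg)
  moreover have "tail_error w l (insert a \<beta>) \<le> tail_error w l \<beta>"
    unfolding tail_error_def using assms
    by (intro suminf_le summable_sqdist mult_left_mono)
      (auto simp: weight_nonneg sqdist_insert)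
  ultimately show ?thesis
    using tail_error_split[of "insert a \<beta>" i l] assms by simp
qed

text \<open>The integers from \<open>i\<close> on that are served by the smallest point \<open>a\<close> of
  \<open>\<alpha>\<close> form an initial segment, which is empty if \<open>l = i\<close>.\<close>

lemma tail_error_remove_Min:
  assumes "finite \<alpha>" "card \<alpha> = Suc m" "m \<ge> 1"
  obtains a \<beta> l where "\<alpha> = insert a \<beta>" "finite \<beta>" "card \<beta> = m" "\<beta> \<noteq> {}" "i \<le> l"
    "tail_error w i \<alpha> = (\<Sum>j=i..<l. w j * (real j - a)\<^sup>2) + tail_error w l \<beta>"
proof -
  define a where "a = Min \<alpha>"
  define \<beta> where "\<beta> = \<alpha> - {a}"
  define b where "b = Min \<beta>"
  have "\<alpha> \<noteq> {}" using assms by auto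
  then have a: "a \<in> \<alpha>" and a_le: "\<And>c. c \<in> \<alpha> \<Longrightarrow> a \<le> c"
    using assms by (auto simp: a_def)
  have \<alpha>: "\<alpha> = insert a \<beta>" and fin: "finite \<beta>" and card: "card \<beta> = m"
    using a assms by (auto simp: \<beta>_def)
  have ne: "\<beta> \<noteq> {}" using card \<open>m \<ge> 1\<close> by auto
  have b: "b \<in> \<beta>" and b_le: "\<And>c. c \<in> \<beta> \<Longrightarrow> b \<le> c"
    using fin ne by (auto simp: b_def)
  have a_less: "a < c" if "c \<in> \<beta>" for c
    using that a_le[of c] by (auto simp: \<beta>_def)
  have below: "sqdist \<alpha> x = (x - a)\<^sup>2" if "2 * x \<le> a + b" for x
  proof -
    have "(x - a)\<^sup>2 \<le> (x - c)\<^sup>2" if "c \<in> \<beta>" for c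
      using square_diff_le_iff[OF a_less[OF that], of x] b_le[OF that] \<open>2 * x \<le> a + b\<close> by linarith
    then have "(x - a)\<^sup>2 \<le> sqdist \<beta> x"
      using fin ne by (simp add: sqdist_def)
    then show ?thesis
      using fin ne by (simp add: \<alpha> sqdist_insert)
  qed
  have above: "sqdist \<alpha> x = sqdist \<beta> x" if "2 * x > a + b" for x
  proof -
    have "sqdist \<beta> x \<le> (x - a)\<^sup>2"
      using square_diff_le_iff[OF a_less[OF b], of x] that sqdist_le[OF fin b, of x] by linarith
    then show ?thesis
      using fin ne by (simp add: \<alpha> sqdist_insert)
  qed
  \<comment> \<open>The first integer from \<open>i\<close> on beyond the midpoint of the two
    smallest means; an integer at the midpoint goes to \<open>a\<close>.\<close>
  define l where "l = (LEAST j. i \<le> j \<and> 2 * real j > a + b)"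
  obtain j where "real j > max (real i) (a + b)"
    using reals_Archimedean2 by blast
  then have "i \<le> j \<and> 2 * real j > a + b" by linarith
  then have l: "i \<le> l" "2 * real l > a + b"
    unfolding l_def by (rule LeastI2; simp)+
  have "(\<Sum>j=i..<l. w j * sqdist \<alpha> (real j)) = (\<Sum>j=i..<l. w j * (real j - a)\<^sup>2)"
  proof (rule sum.cong)
    fix j assume "j \<in> {i..<l}"
    then have "2 * real j \<le> a + b"
      using not_less_Least[of j "\<lambda>j. i \<le> j \<and> 2 * real j > a + b"] by (auto simp: l_def)
    then show "w j * sqdist \<alpha> (real j) = w j * (real j - a)\<^sup>2"
      by (simp add: below)
  qed simp
  moreover have "tail_error w l \<alpha> = tail_error w l \<beta>"
  proof -
    have "sqdist \<alpha> (real (j + l)) = sqdist \<beta> (real (j + l))" for j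
      using l(2) by (intro above) simp
    then show ?thesis by (simp add: tail_error_def)
  qed
  ultimately show ?thesis
    using tail_error_split[OF assms(1) \<open>\<alpha> \<noteq> {}\<close> l(1)]
    by (intro that[OF \<alpha> fin card ne l(1)]) simp
qed

lemma sum_weight_square_mono:
  "l \<le> l' \<Longrightarrow> (\<Sum>j=i..<l. w j * (real j - a)\<^sup>2) \<le> (\<Sum>j=i..<l'. w j * (real j - a)\<^sup>2)"
  by (rule sum_mono2) (auto simp: weight_nonneg)

text \<open>The bound is the least cost of serving two adjacent atoms by one point, attained at
  their weighted mean. Multiplied by the total weight, the excess over it is the square of the
  weighted sum of deviations.\<close>

lemma pair_cost_le:
  assumes "i + 2 \<le> l" "w i + w (Suc i) > 0"
  shows "w i * w (Suc i) / (w i + w (Suc i)) \<le> (\<Sum>j=i..<l. w j * (real j - a)\<^sup>2)"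
proof -
  have "w i * w (Suc i) \<le>
      (w i * (real i - a)\<^sup>2 + w (Suc i) * (real (Suc i) - a)\<^sup>2) * (w i + w (Suc i))"
  proof -
    have "(w i * (real i - a)\<^sup>2 + w (Suc i) * (real (Suc i) - a)\<^sup>2) * (w i + w (Suc i))
        - w i * w (Suc i) = (w i * (real i - a) + w (Suc i) * (real (Suc i) - a))\<^sup>2"
      by (simp add: power2_eq_square algebra_simps)
    then show ?thesis using zero_le_power2 by (metis diff_ge_0_iff_ge)
  qed
  then have "w i * w (Suc i) / (w i + w (Suc i)) \<le>
      w i * (real i - a)\<^sup>2 + w (Suc i) * (real (Suc i) - a)\<^sup>2"
    using assms by (simp add: divide_le_eq)
  also have "\<dots> = (\<Sum>j=i..<i+2. w j * (real j - a)\<^sup>2)"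
    by (simp add: numeral_2_eq_2)
  also have "\<dots> \<le> (\<Sum>j=i..<l. w j * (real j - a)\<^sup>2)"
    by (rule sum_weight_square_mono[OF assms(1)])
  finally show ?thesis .
qed

section \<open>One, two and three means for weights \<open>1 / 2 ^ j\<close>\<close>

context
  fixes i :: nat
  assumes geometric: "\<And>j. i \<le> j \<Longrightarrow> w j = 1 / 2 ^ j"
begin

lemma geometric_tail_error_singleton:
  assumes "i \<le> l"
  shows "tail_error w l {a} = (4 + 2 * (a - real l - 1)\<^sup>2) / 2 ^ l"
proof -
  have "(\<lambda>j. (real j - (a - real l))\<^sup>2 / 2 ^ j / 2 ^ l) sums
      ((4 + 2 * (a - real l - 1)\<^sup>2) / 2 ^ l)"
    using sums_divide[OF sums_geometric_square] .
  moreover have "(real j - (a - real l))\<^sup>2 / 2 ^ j / 2 ^ l = w (j + l) * sqdist {a} (real (j + l))" for j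
    using assms by (simp add: geometric power_add algebra_simps)
  ultimately show ?thesis
    unfolding tail_error_def by (simp add: sums_iff)
qed

text \<open>In this and the next three lemmas the square is completed around the weighted mean of
  the block. Up to the factor \<open>1 / 2 ^ i\<close>, the constant is the least cost of the block
  and the coefficient of the square is its mass.\<close>

lemma geometric_sum_1: "(\<Sum>j=i..<i+1. w j * (real j - a)\<^sup>2) = (a - real i)\<^sup>2 / 2 ^ i"
  by (simp add: geometric power2_commute)

lemma geometric_sum_2:
  "(\<Sum>j=i..<i+2. w j * (real j - a)\<^sup>2) = (1 / 3 + 3 / 2 * (a - real i - 1 / 3)\<^sup>2) / 2 ^ i"
  by (simp add: numeral_eq_Suc geometric power2_eq_square field_simps)

lemma geometric_sum_3:
  "(\<Sum>j=i..<i+3. w j * (real j - a)\<^sup>2) = (13 / 14 + 7 / 4 * (a - real i - 4 / 7)\<^sup>2) / 2 ^ i"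
  by (simp add: numeral_eq_Suc geometric power2_eq_square field_simps)

lemma geometric_sum_4:
  "(\<Sum>j=i..<i+4. w j * (real j - a)\<^sup>2) = (97 / 60 + 15 / 8 * (a - real i - 11 / 15)\<^sup>2) / 2 ^ i"
  by (simp add: numeral_eq_Suc geometric power2_eq_square field_simps)

end

text \<open>The length of the first block is scanned. After scaling by \<open>2 ^ i\<close>, the
  total is at least 4, 2, 1/3 + 1 and 13/14 + 1/2 for lengths 0, 1, 2 and 3, and the block alone
  costs at least 97/60 for longer ones. So length 2 wins, and the two completed squares then fix
  both points. The disjunction records the bound and the uniqueness together, as the recursion needs
  both.\<close>

lemma geometric_tail_error_card2:
  assumes geometric: "\<And>j. i \<le> j \<Longrightarrow> w j = 1 / 2 ^ j" and "card \<alpha> = 2"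
  shows "4 / 3 / 2 ^ i < tail_error w i \<alpha> \<or>
    tail_error w i \<alpha> = 4 / 3 / 2 ^ i \<and> \<alpha> = {real i + 1 / 3, real i + 3}"
proof -
  have "finite \<alpha>" using assms(2) by (simp add: card_ge_0_finite)
  then obtain a \<beta> l where split: "\<alpha> = insert a \<beta>" "finite \<beta>" "card \<beta> = 1" "i \<le> l"
    "tail_error w i \<alpha> = (\<Sum>j=i..<l. w j * (real j - a)\<^sup>2) + tail_error w l \<beta>"
    by (rule tail_error_remove_Min[where m = 1 and i = i]) (use assms(2) in auto)
  obtain b where \<beta>: "\<beta> = {b}" using split(3) card_1_singletonE by blast
  define X where "X = 2 ^ i * (\<Sum>j=i..<l. w j * (real j - a)\<^sup>2)"
  define Y where "Y = 2 ^ i * tail_error w l \<beta>"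
  have T: "tail_error w i \<alpha> = (X + Y) / 2 ^ i"
    by (simp add: X_def Y_def split(5) field_simps)
  have Y: "Y = (4 + 2 * (b - real l - 1)\<^sup>2) / 2 ^ k" if "l = i + k" for k
    using geometric_tail_error_singleton[OF geometric split(4)] that
    by (simp add: Y_def \<beta> power_add)
  have "0 \<le> Y"
    using tail_error_nonneg[of \<beta> l] by (simp add: Y_def \<beta>)
  have X_ge: "2 ^ i * (\<Sum>j=i..<l'. w j * (real j - a)\<^sup>2) \<le> X" if "l' \<le> l" for l'
    unfolding X_def by (intro mult_left_mono sum_weight_square_mono that) simp
  consider "l = i + 0" | "l = i + 1" | "l = i + 2" | "l = i + 3" | "i + 4 \<le> l"
    using split(4) by linarith
  then have "4 / 3 < X + Y \<or> X + Y = 4 / 3 \<and> \<alpha> = {real i + 1 / 3, real i + 3}"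
  proof cases
    case 1
    with Y[OF 1] show ?thesis by (simp add: X_def add_pos_nonneg)
  next
    case 2
    have "0 \<le> X" using X_ge[of i] split(4) by simp
    moreover have "2 \<le> Y" by (simp add: Y[OF 2])
    ultimately show ?thesis by linarith
  next
    case 3
    have "X = 1 / 3 + 3 / 2 * (a - real i - 1 / 3)\<^sup>2"
      by (simp only: X_def 3 geometric_sum_2[OF geometric]) simp
    moreover have "Y = 1 + (b - real i - 3)\<^sup>2 / 2"
      by (simp add: Y[OF 3] 3 field_simps power2_eq_square)
    moreover have "\<alpha> = {real i + 1 / 3, real i + 3}"
      if "(a - real i - 1 / 3)\<^sup>2 = 0" "(b - real i - 3)\<^sup>2 = 0"
      using that by (auto simp: split(1) \<beta>)
    ultimately show ?thesis
      using zero_le_power2[of "a - real i - 1 / 3"] zero_le_power2[of "b - real i - 3"] by linarith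
  next
    case 4
    have "X = 13 / 14 + 7 / 4 * (a - real i - 4 / 7)\<^sup>2"
      by (simp only: X_def 4 geometric_sum_3[OF geometric]) simp
    moreover have "Y = 1 / 2 + (b - real l - 1)\<^sup>2 / 4"
      by (simp add: Y[OF 4] field_simps)
    ultimately show ?thesis
      using zero_le_power2[of "a - real i - 4 / 7"] zero_le_power2[of "b - real l - 1"] by linarith
  next
    case 5
    have "97 / 60 + 15 / 8 * (a - real i - 11 / 15)\<^sup>2 \<le> X"
      using X_ge[OF 5] by (simp add: geometric_sum_4[OF geometric])
    with \<open>0 \<le> Y\<close> show ?thesis
      using zero_le_power2[of "a - real i - 11 / 15"] by linarith
  qed
  then show ?thesis
    using divide_strict_right_mono[of "4 / 3" "X + Y" "2 ^ i"]
    by (auto simp only: T zero_less_power zero_less_numeral simp_thms)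
qed

text \<open>With the two-means bound for the rest, the scaled totals for first blocks of length 0, 1
  and 2 are at least 4/3, 0 + 2/3 and 1/3 + 1/3, while longer blocks alone cost at least 13/14. The
  tie between lengths 1 and 2 produces the two optimal sets.\<close>

lemma geometric_tail_error_card3:
  assumes geometric: "\<And>j. i \<le> j \<Longrightarrow> w j = 1 / 2 ^ j" and "card \<alpha> = 3"
  shows "2 / 3 / 2 ^ i < tail_error w i \<alpha> \<or>
    tail_error w i \<alpha> = 2 / 3 / 2 ^ i \<and>
      \<alpha> \<in> {{real i, real i + 4 / 3, real i + 4}, {real i + 1 / 3, real i + 7 / 3, real i + 5}}"
proof -
  have "finite \<alpha>" using assms(2) by (simp add: card_ge_0_finite)
  then obtain a \<beta> l where split: "\<alpha> = insert a \<beta>" "finite \<beta>" "card \<beta> = 2" "\<beta> \<noteq> {}" "i \<le> l"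
    "tail_error w i \<alpha> = (\<Sum>j=i..<l. w j * (real j - a)\<^sup>2) + tail_error w l \<beta>"
    by (rule tail_error_remove_Min[where m = 2 and i = i]) (use assms(2) in auto)
  define X where "X = 2 ^ i * (\<Sum>j=i..<l. w j * (real j - a)\<^sup>2)"
  define Y where "Y = 2 ^ i * tail_error w l \<beta>"
  have T: "tail_error w i \<alpha> = (X + Y) / 2 ^ i"
    by (simp add: X_def Y_def split(6) field_simps)
  have card2: "4 / 3 / 2 ^ l < tail_error w l \<beta> \<or>
      tail_error w l \<beta> = 4 / 3 / 2 ^ l \<and> \<beta> = {real l + 1 / 3, real l + 3}"
    using split(5) by (intro geometric_tail_error_card2 geometric split(3)) simp
  have Y: "4 / 3 / 2 ^ k < Y \<or> Y = 4 / 3 / 2 ^ k \<and> \<beta> = {real l + 1 / 3, real l + 3}"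
    if "l = i + k" for k
    using card2 by (simp add: Y_def that power_add field_simps)
  have "0 \<le> Y"
    using tail_error_nonneg[OF split(2,4), of l] by (simp add: Y_def)
  consider "l = i + 0" | "l = i + 1" | "l = i + 2" | "i + 3 \<le> l"
    using split(5) by linarith
  then have "2 / 3 < X + Y \<or> X + Y = 2 / 3 \<and>
      \<alpha> \<in> {{real i, real i + 4 / 3, real i + 4}, {real i + 1 / 3, real i + 7 / 3, real i + 5}}"
  proof cases
    case 1
    with Y[OF 1] show ?thesis by (auto simp: X_def)
  next
    case 2
    have X: "X = (a - real i)\<^sup>2"
      by (simp only: X_def 2 geometric_sum_1[OF geometric]) simp
    from Y[OF 2] show ?thesis
    proof (elim disjE conjE)
      assume "4 / 3 / 2 ^ 1 < Y"
      then have "2 / 3 < Y" by simp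
      then show ?thesis by (simp add: X add_nonneg_pos add_strict_increasing2)
    next
      assume "Y = 4 / 3 / 2 ^ 1" and \<beta>: "\<beta> = {real l + 1 / 3, real l + 3}"
      then have Y: "Y = 2 / 3" by simp
      show ?thesis
      proof (cases "a = real i")
        case True
        then show ?thesis by (simp add: X Y \<beta> split(1) 2 add_ac)
      next
        case False
        then show ?thesis by (simp add: X Y)
      qed
    qed
  next
    case 3
    have X: "X = 1 / 3 + 3 / 2 * (a - real i - 1 / 3)\<^sup>2"
      by (simp only: X_def 3 geometric_sum_2[OF geometric]) simp
    from Y[OF 3] show ?thesis
    proof (elim disjE conjE)
      assume "4 / 3 / 2 ^ 2 < Y"
      then have "1 / 3 < Y" by simp
      then show ?thesis
        using X zero_le_power2[of "a - real i - 1 / 3"] by linarith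
    next
      assume "Y = 4 / 3 / 2 ^ 2" and \<beta>: "\<beta> = {real l + 1 / 3, real l + 3}"
      then have Y: "Y = 1 / 3" by simp
      show ?thesis
      proof (cases "a = real i + 1 / 3")
        case True
        then show ?thesis by (simp add: X Y \<beta> split(1) 3 add_ac)
      next
        case False
        then have "0 < (a - real i - 1 / 3)\<^sup>2" by simp
        then show ?thesis using X Y by linarith
      qed
    qed
  next
    case 4
    have "13 / 14 + 7 / 4 * (a - real i - 4 / 7)\<^sup>2 \<le> X"
      using mult_left_mono[OF sum_weight_square_mono[OF 4, of a i], of "2 ^ i"]
      by (simp add: X_def geometric_sum_3[OF geometric])
    with \<open>0 \<le> Y\<close> show ?thesis
      using zero_le_power2[of "a - real i - 4 / 7"] by linarith
  qed
  then show ?thesis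
    using divide_strict_right_mono[of "2 / 3" "X + Y" "2 ^ i"]
    by (auto simp only: T zero_less_power zero_less_numeral simp_thms)
qed

end

section \<open>The two families of candidates\<close>

lemma atLeastLessThan_rec: "i < k \<Longrightarrow> {i..<k} = insert i {Suc i..<k}" for i k :: nat
  by auto

text \<open>The candidate optimal sets with \<open>e - i\<close> points for the integers from \<open>i\<close> on.
  Keeping \<open>e\<close> fixed makes the recursion in \<open>i\<close> a mere insertion of \<open>i\<close>.\<close>

definition one_pair_means :: "nat \<Rightarrow> nat \<Rightarrow> real set" where
  "one_pair_means i e = real ` {i..<e - 2} \<union> {real e - 5 / 3, real e + 1}"

text \<open>For weights \<open>1 / 2 ^ j\<close>, the last three points are the means of the blocks
  \<open>{e - 3, e - 2}\<close>, \<open>{e - 1, e}\<close> and \<open>{e + 1..}\<close>; in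
  \<open>one_pair_means\<close> the last two belong to \<open>{e - 2, e - 1}\<close> and
  \<open>{e..}\<close>.\<close>

definition two_pair_means :: "nat \<Rightarrow> nat \<Rightarrow> real set" where
  "two_pair_means i e = real ` {i..<e - 3} \<union> {real e - 8 / 3, real e - 2 / 3, real e + 2}"

lemma one_pair_means_rec:
  "i < e - 2 \<Longrightarrow> one_pair_means i e = insert (real i) (one_pair_means (Suc i) e)"
  by (simp add: one_pair_means_def atLeastLessThan_rec[of i] insert_commute)

lemma two_pair_means_rec:
  "i < e - 3 \<Longrightarrow> two_pair_means i e = insert (real i) (two_pair_means (Suc i) e)"
  by (simp add: two_pair_means_def atLeastLessThan_rec[of i] insert_commute)

section \<open>Optimal sets for the permuted weights\<close>

locale permuted_geometric_weights = square_summable_weights +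
  assumes w1: "w 1 = 1 / 8" and w2: "w 2 = 1 / 4" and w3: "w 3 = 1 / 2"
    and w_geometric: "4 \<le> j \<Longrightarrow> w j = 1 / 2 ^ j"
begin

lemma w_geometric_from: "4 \<le> i \<Longrightarrow> i \<le> j \<Longrightarrow> w j = 1 / 2 ^ j"
  by (simp add: w_geometric)

text \<open>The pairs starting at 1, 2 and 3 cost at least 1/12, 1/6 and 1/18. The threshold 1/24 is
  the claimed quantization error for \<open>n = 6\<close>, the largest one considered.\<close>

lemma front_pair_cost:
  assumes "1 \<le> i" "i \<le> 3" "i + 2 \<le> l"
  shows "1 / 24 < (\<Sum>j=i..<l. w j * (real j - a)\<^sup>2)"
proof -
  have w4: "w 4 = 1 / 16" by (simp add: w_geometric)
  consider "i = 1" | "i = 2" | "i = 3" using assms by linarith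
  then show ?thesis
    using pair_cost_le[OF assms(3), of a]
    by cases (simp_all add: w1[unfolded One_nat_def] w2 w2[unfolded numeral_2_eq_2] w3 w4)
qed

text \<open>With \<open>i + m \<le> 6\<close> there are too few means. For \<open>i \<le> 3\<close>,
  a first block of length at least 2 is already too expensive, and a shorter one uses up a mean
  while \<open>l + (m - 1) \<le> i + m\<close> keeps the condition. At \<open>i = 4\<close> at most
  two means are left, with errors at least 1/4 and 1/12.\<close>

lemma front_tail_error:
  assumes "finite \<alpha>" "card \<alpha> = m" "1 \<le> m" "1 \<le> i" "i \<le> 4" "i + m \<le> 6"
  shows "1 / 24 < tail_error w i \<alpha>"
  using \<open>1 \<le> m\<close> assms
proof (induction m arbitrary: i \<alpha> rule: nat_induct_at_least)
  case base
  then obtain a where \<alpha>: "\<alpha> = {a}" using card_1_singletonE by blast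
  show ?case
  proof (cases "i = 4")
    case True
    have "1 / 4 \<le> tail_error w 4 {a}"
      by (subst geometric_tail_error_singleton[of 4]) (auto intro: w_geometric)
    then show ?thesis by (simp add: True \<alpha>)
  next
    case False
    have "1 / 24 < (\<Sum>j=i..<i+2. w j * (real j - a)\<^sup>2)"
      using False base.prems by (intro front_pair_cost) auto
    also have "\<dots> \<le> tail_error w i \<alpha>"
      using tail_error_split[of "{a}" i "i + 2"] tail_error_nonneg[of "{a}" "i + 2"]
      by (simp add: \<alpha>)
    finally show ?thesis .
  qed
next
  case (Suc m)
  show ?case
  proof (cases "i = 4")
    case True
    then show ?thesis
      using geometric_tail_error_card2[of 4 \<alpha>, OF w_geometric] Suc by auto
  next
    case False
    then have "i \<le> 3" using Suc.prems by simp
    obtain a \<beta> l where split: "finite \<beta>" "card \<beta> = m" "\<beta> \<noteq> {}" "i \<le> l"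
      "tail_error w i \<alpha> = (\<Sum>j=i..<l. w j * (real j - a)\<^sup>2) + tail_error w l \<beta>"
      by (rule tail_error_remove_Min[of \<alpha> m i]) (use Suc in auto)
    have sum_nonneg: "0 \<le> (\<Sum>j=i..<l. w j * (real j - a)\<^sup>2)"
      by (intro sum_nonneg) (simp add: weight_nonneg)
    show ?thesis
    proof (cases "i + 2 \<le> l")
      case True
      then show ?thesis
        using front_pair_cost[of i l a] tail_error_nonneg[of \<beta> l] split Suc.prems \<open>i \<le> 3\<close> by simp
    next
      case False
      then have "1 / 24 < tail_error w l \<beta>"
        using Suc.prems Suc.hyps split \<open>i \<le> 3\<close> by (intro Suc.IH) auto
      then show ?thesis using sum_nonneg split(5) by linarith
    qed
  qed
qed

text \<open>The bound depends only on \<open>i + m\<close>, which is unchanged when a singleton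
  block and its mean are removed. The condition \<open>7 \<le> i + m\<close> puts the base case
  \<open>m = 3\<close> into the geometric range \<open>4 \<le> i\<close>.\<close>

lemma tail_error_optimal:
  assumes "finite \<alpha>" "card \<alpha> = m" "3 \<le> m" "1 \<le> i" "7 \<le> i + m"
  shows "16 / (3 * 2 ^ (i + m)) < tail_error w i \<alpha> \<or>
    tail_error w i \<alpha> = 16 / (3 * 2 ^ (i + m)) \<and>
      \<alpha> \<in> {one_pair_means i (i + m), two_pair_means i (i + m)}"
  using \<open>3 \<le> m\<close> assms
proof (induction m arbitrary: i \<alpha> rule: nat_induct_at_least)
  case base
  have "2 / 3 / 2 ^ i = (16 :: real) / (3 * 2 ^ (i + 3))"
    by (simp add: power_add)
  moreover have "one_pair_means i (i + 3) = {real i, real i + 4 / 3, real i + 4}"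
    "two_pair_means i (i + 3) = {real i + 1 / 3, real i + 7 / 3, real i + 5}"
    by (simp_all add: one_pair_means_def two_pair_means_def algebra_simps insert_commute)
  ultimately show ?case
    using geometric_tail_error_card3[of i \<alpha>, OF w_geometric_from[of i]] base.prems by simp
next
  case (Suc m)
  define V :: real where "V = 16 / (3 * 2 ^ (i + Suc m))"
  have "0 < V" by (simp add: V_def)
  have V_front: "V \<le> 1 / 24"
    using power_increasing[of 7 "i + Suc m" "2::real"] Suc.prems
    by (simp add: V_def field_simps)
  obtain a \<beta> l where split: "\<alpha> = insert a \<beta>" "finite \<beta>" "card \<beta> = m" "\<beta> \<noteq> {}" "i \<le> l"
    "tail_error w i \<alpha> = (\<Sum>j=i..<l. w j * (real j - a)\<^sup>2) + tail_error w l \<beta>"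
    by (rule tail_error_remove_Min[of \<alpha> m i]) (use Suc in auto)
  have IH: "16 / (3 * 2 ^ (l + m)) < tail_error w l \<beta> \<or>
      tail_error w l \<beta> = 16 / (3 * 2 ^ (l + m)) \<and>
      \<beta> \<in> {one_pair_means l (l + m), two_pair_means l (l + m)}" if "7 \<le> l + m"
    using that split Suc.hyps Suc.prems by (intro Suc.IH) auto
  consider "l = i" | "l = Suc i" | "i + 2 \<le> l" using split(5) by linarith
  then have "V < tail_error w i \<alpha> \<or>
    tail_error w i \<alpha> = V \<and> \<alpha> \<in> {one_pair_means i (i + Suc m), two_pair_means i (i + Suc m)}"
  proof cases
    \<comment> \<open>Here \<open>a\<close> serves no integer, so one mean is wasted: the bound for
      the remaining ones is \<open>2 * V\<close>, or, if \<open>i + m = 6\<close>, the error exceeds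
      1/24.\<close>
    case 1
    show ?thesis
    proof (cases "7 \<le> i + m")
      case True
      have "16 / (3 * 2 ^ (l + m)) = 2 * V" by (simp add: V_def 1)
      then show ?thesis using IH \<open>0 < V\<close> True split(6) by (auto simp: 1)
    next
      case False
      have "1 / 24 < tail_error w l \<beta>"
        using False 1 Suc.hyps Suc.prems split by (intro front_tail_error[of _ m]) auto
      then show ?thesis using V_front split(6) by (simp add: 1)
    qed
  next
    case 2
    \<comment> \<open>Positive weight makes the singleton block free only for
      \<open>a = real i\<close>, which gives uniqueness.\<close>
    have "0 < w i"
    proof -
      consider "i = 1" | "i = 2" | "i = 3" | "4 \<le> i" using Suc.prems by linarith
      then show ?thesis by cases (simp_all add: w1[unfolded One_nat_def] w2 w3 w_geometric)
    qed
    then have "tail_error w i \<alpha> \<ge> tail_error w l \<beta>"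
      "tail_error w i \<alpha> = tail_error w l \<beta> \<Longrightarrow> a = real i"
      using split(6) by (simp_all add: 2)
    moreover have "16 / (3 * 2 ^ (l + m)) = V" by (simp add: V_def 2)
    moreover have "insert (real i) (one_pair_means l (l + m)) = one_pair_means i (i + Suc m)"
      "insert (real i) (two_pair_means l (l + m)) = two_pair_means i (i + Suc m)"
      using Suc.hyps by (simp_all add: 2 one_pair_means_rec[of i] two_pair_means_rec[of i])
    moreover have "7 \<le> l + m" using Suc.prems by (simp add: 2)
    from IH[OF this] have "V < tail_error w l \<beta> \<or> tail_error w l \<beta> = V \<and>
        insert (real i) \<beta> \<in> {one_pair_means i (i + Suc m), two_pair_means i (i + Suc m)}"
      using calculation(3-5) by auto
    ultimately show ?thesis
      unfolding split(1) by (metis order_le_less order_less_le_trans)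
  next
    case 3
    show ?thesis
    proof (cases "i \<le> 3")
      case True
      then show ?thesis
        using front_pair_cost[of i l a] 3 Suc.prems V_front split(6)
          tail_error_nonneg[OF split(2,4), of l] by simp
    next
      case False
      have "V \<le> 1 / 3 / 2 ^ i"
        using power_increasing[of 4 "Suc m" "2::real"] Suc.hyps
        by (simp add: V_def power_add field_simps)
      also have "\<dots> \<le> (\<Sum>j=i..<i+2. w j * (real j - a)\<^sup>2)"
        using False geometric_sum_2[of i a, OF w_geometric_from[of i]]
        by (simp add: divide_right_mono flip: divide_divide_eq_left)
      also have "\<dots> \<le> (\<Sum>j=i..<l. w j * (real j - a)\<^sup>2)"
        by (rule sum_weight_square_mono[OF 3])
      finally have "V \<le> (\<Sum>j=i..<l. w j * (real j - a)\<^sup>2)" .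
      \<comment> \<open>For \<open>m = 3\<close> the pair cost can equal \<open>V\<close>, so
        strictness has to come from the remaining tail.\<close>
      moreover have "0 < tail_error w l \<beta>"
      proof -
        have "7 \<le> l + m" using 3 Suc.prems by simp
        moreover have "(0::real) < 16 / (3 * 2 ^ (l + m))" by simp
        ultimately show ?thesis using IH by linarith
      qed
      ultimately show ?thesis using split(6) by simp
    qed
  qed
  then show ?case by (simp add: V_def)
qed

text \<open>Induction runs downwards from \<open>i = e - 2\<close>, where only the pair and the
  infinite block remain, with costs \<open>1 / 3 / 2 ^ i\<close> and \<open>1 / 2 ^ i\<close>. Each
  integer added in front is itself a mean and costs nothing.\<close>

lemma tail_error_one_pair_means:
  assumes "i \<le> e - 2" "6 \<le> e"
  shows "tail_error w i (one_pair_means i e) \<le> 16 / (3 * 2 ^ e)"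
  using \<open>i \<le> e - 2\<close>
proof (induction rule: inc_induct)
  case base
  obtain d where e: "e = d + 2" "4 \<le> d"
    using \<open>6 \<le> e\<close> by (intro that[of "e - 2"]) auto
  have "one_pair_means d (d + 2) = insert (real d + 1 / 3) {real d + 3}"
    by (auto simp: one_pair_means_def)
  then have "tail_error w d (one_pair_means d (d + 2)) \<le>
      (\<Sum>j=d..<d+2. w j * (real j - (real d + 1 / 3))\<^sup>2) + tail_error w (d + 2) {real d + 3}"
    using tail_error_insert_le[of "{real d + 3}" d "d + 2" "real d + 1 / 3"] by simp
  also have "(\<Sum>j=d..<d+2. w j * (real j - (real d + 1 / 3))\<^sup>2) = 1 / 3 / 2 ^ d"
    by (subst geometric_sum_2) (auto intro: w_geometric_from e(2))
  also have "tail_error w (d + 2) {real d + 3} = 1 / 2 ^ d"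
    by (subst geometric_tail_error_singleton[of d]) (auto intro: w_geometric_from e(2))
  also have "1 / 3 / 2 ^ d + 1 / 2 ^ d = (16 :: real) / (3 * 2 ^ (d + 2))"
    by (simp add: field_simps)
  finally show ?case by (simp add: e(1))
next
  case (step i)
  then show ?case
    using tail_error_insert_le[of "one_pair_means (Suc i) e" i "Suc i" "real i"]
    by (simp add: one_pair_means_rec[of i]) (simp add: one_pair_means_def)
qed

lemma tail_error_two_pair_means:
  assumes "i \<le> e - 3" "7 \<le> e"
  shows "tail_error w i (two_pair_means i e) \<le> 16 / (3 * 2 ^ e)"
  using \<open>i \<le> e - 3\<close>
proof (induction rule: inc_induct)
  case base
  obtain d where e: "e = d + 3" "4 \<le> d"
    using \<open>7 \<le> e\<close> by (intro that[of "e - 3"]) auto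
  \<comment> \<open>Behind its first pair the set is a \<open>one_pair_means\<close> set without
    integer prefix, so the previous lemma bounds the rest.\<close>
  have "two_pair_means d (d + 3) = insert (real d + 1 / 3) (one_pair_means (d + 2) (d + 4))"
    by (auto simp: one_pair_means_def two_pair_means_def)
  then have "tail_error w d (two_pair_means d (d + 3)) \<le>
      (\<Sum>j=d..<d+2. w j * (real j - (real d + 1 / 3))\<^sup>2) +
      tail_error w (d + 2) (one_pair_means (d + 2) (d + 4))"
    using tail_error_insert_le[of "one_pair_means (d + 2) (d + 4)" d "d + 2" "real d + 1 / 3"]
    by (simp add: one_pair_means_def)
  also have "(\<Sum>j=d..<d+2. w j * (real j - (real d + 1 / 3))\<^sup>2) = 1 / 3 / 2 ^ d"
    by (subst geometric_sum_2) (auto intro: w_geometric_from e(2))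
  also have "tail_error w (d + 2) (one_pair_means (d + 2) (d + 4)) \<le> 16 / (3 * 2 ^ (d + 4))"
    using e(2) by (intro tail_error_one_pair_means) auto
  also have "1 / 3 / 2 ^ d + 16 / (3 * 2 ^ (d + 4)) = (16 :: real) / (3 * 2 ^ (d + 3))"
    by (simp add: field_simps power_add)
  finally show ?case by (simp add: e(1))
next
  case (step i)
  then show ?case
    using tail_error_insert_le[of "two_pair_means (Suc i) e" i "Suc i" "real i"]
    by (simp add: two_pair_means_rec[of i]) (simp add: two_pair_means_def)
qed

text \<open>At most five means fall under \<open>front_tail_error\<close>. From six on, each further
  mean halves the bound, so using fewer than \<open>n\<close> means is strictly worse.\<close>

lemma tail_error_optimal_le:
  assumes "finite \<alpha>" "1 \<le> card \<alpha>" "card \<alpha> \<le> n" "6 \<le> n"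
  shows "16 / (3 * 2 ^ (n + 1)) < tail_error w 1 \<alpha> \<or>
    tail_error w 1 \<alpha> = 16 / (3 * 2 ^ (n + 1)) \<and>
      \<alpha> \<in> {one_pair_means 1 (n + 1), two_pair_means 1 (n + 1)}"
proof (cases "card \<alpha> \<le> 5")
  case True
  have "(16 :: real) / (3 * 2 ^ (n + 1)) \<le> 1 / 24"
    using power_increasing[of 7 "n + 1" "2::real"] \<open>6 \<le> n\<close> by (simp add: field_simps)
  moreover have "1 / 24 < tail_error w 1 \<alpha>"
    using assms True by (intro front_tail_error[of _ "card \<alpha>"]) auto
  ultimately show ?thesis by linarith
next
  case False
  have *: "16 / (3 * 2 ^ (1 + card \<alpha>)) < tail_error w 1 \<alpha> \<or>
    tail_error w 1 \<alpha> = 16 / (3 * 2 ^ (1 + card \<alpha>)) \<and>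
      \<alpha> \<in> {one_pair_means 1 (1 + card \<alpha>), two_pair_means 1 (1 + card \<alpha>)}"
    using assms False by (intro tail_error_optimal) auto
  show ?thesis
  proof (cases "card \<alpha> = n")
    case True
    then show ?thesis using * by (simp only: add.commute)
  next
    case False
    have "(16 :: real) / (3 * 2 ^ (n + 1)) < 16 / (3 * 2 ^ (1 + card \<alpha>))"
      using assms False by (intro divide_strict_left_mono mult_strict_left_mono) auto
    then show ?thesis using * by linarith
  qed
qed

end

section \<open>From integrals over the measure to series\<close>

lemma dirac_series_eq_distr:
  "dirac_series p =
    distr (density (count_space UNIV) (\<lambda>j. ennreal (p (Suc j)))) borel (\<lambda>j. real (Suc j))"
proof (rule measure_eqI)
  fix A assume "A \<in> sets (dirac_series p)"
  then show "emeasure (dirac_series p) A =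
      emeasure (distr (density (count_space UNIV) (\<lambda>j. ennreal (p (Suc j)))) borel (\<lambda>j. real (Suc j))) A"
    by (simp add: emeasure_dirac_series emeasure_distr emeasure_density
        nn_integral_count_space_nat indicator_def vimage_def)
qed simp

lemma nn_integral_dirac_series:
  assumes "f \<in> borel_measurable borel"
  shows "(\<integral>\<^sup>+ x. f x \<partial>dirac_series p) = (\<Sum>j. ennreal (p (Suc j)) * f (real (Suc j)))"
  using assms
  by (simp add: dirac_series_eq_distr nn_integral_distr nn_integral_density
      nn_integral_count_space_nat)

lemma measure_dirac_series_singleton:
  assumes "1 \<le> m" "0 \<le> p m"
  shows "measure (dirac_series p) {real m} = p m"
proof -
  have "emeasure (dirac_series p) {real m} =
      (\<Sum>j. ennreal (p (Suc j)) * indicator {real m} (real (Suc j)))"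
    by (simp add: emeasure_dirac_series)
  also have "\<dots> = (\<Sum>j\<in>{m - 1}. ennreal (p (Suc j)) * indicator {real m} (real (Suc j)))"
    using assms(1) by (intro suminf_finite) (auto simp: indicator_def)
  also have "\<dots> = ennreal (p m)"
    using assms(1) by simp
  finally show ?thesis
    using assms(2) by (simp add: measure_def)
qed

lemma sqdist_measurable [measurable]: "finite \<alpha> \<Longrightarrow> sqdist \<alpha> \<in> borel_measurable borel"
  unfolding sqdist_def by measurable

lemma (in square_summable_weights) distortion_dirac_series:
  assumes "finite \<alpha>" "\<alpha> \<noteq> {}"
  shows "distortion (dirac_series w) \<alpha> = ennreal (tail_error w 1 \<alpha>)"
proof -
  have "distortion (dirac_series w) \<alpha> =
      (\<Sum>j. ennreal (w (Suc j)) * ennreal (sqdist \<alpha> (real (Suc j))))"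
    unfolding distortion_def sqdist_def[symmetric]
    using assms by (simp add: nn_integral_dirac_series)
  also have "\<dots> = (\<Sum>j. ennreal (w (j + 1) * sqdist \<alpha> (real (j + 1))))"
    by (simp add: ennreal_mult' weight_nonneg)
  also have "\<dots> = ennreal (tail_error w 1 \<alpha>)"
    unfolding tail_error_def using assms
    by (intro suminf_ennreal2 summable_sqdist) (auto simp: weight_nonneg sqdist_nonneg)
  finally show ?thesis .
qed

section \<open>Block averages in the geometric range\<close>

lemma Av_geometric_pair:
  assumes "\<And>j. i \<le> j \<Longrightarrow> measure P {real j} = 1 / 2 ^ j"
  shows "Av P i (Suc i) = real i + 1 / 3"
  by (simp add: Av_def assms field_simps)

lemma Av_inf_geometric:
  assumes "\<And>j. i \<le> j \<Longrightarrow> measure P {real j} = 1 / 2 ^ j"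
  shows "Av_inf P i = real i + 1"
proof -
  have infsum: "(\<Sum>\<^sub>\<infinity>m\<in>{i..}. f m) = s"
    if "(\<lambda>j. f (j + i)) sums s" "\<And>j. 0 \<le> f j" for f :: "nat \<Rightarrow> real" and s
  proof -
    \<comment> \<open>Nonnegative terms turn convergence of the series into the unconditional
      summability behind \<open>infsum\<close>.\<close>
    have "((f \<circ> (\<lambda>j. j + i)) has_sum s) UNIV"
      using that by (auto intro!: sums_nonneg_imp_has_sum simp: o_def)
    then have "(f has_sum s) (range (\<lambda>j. j + i))"
      by (subst has_sum_reindex) (auto simp: inj_on_def)
    also have "range (\<lambda>j. j + i) = {i..}"
      by (auto simp: image_iff intro: le_add_diff_inverse2[symmetric])
    finally show ?thesis by (rule infsumI)
  qed
  have "(\<lambda>j. 1 / 2 ^ (j + i)) sums (2 / 2 ^ i :: real)"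
  proof -
    \<comment> \<open>As in the second telescoping below, \<open>f j\<close> is the remainder of the
      series from index \<open>j\<close> on.\<close>
    define f :: "nat \<Rightarrow> real" where "f j = 2 / 2 ^ (j + i)" for j
    have "f \<longlonglongrightarrow> 0" unfolding f_def by real_asymp
    from telescope_sums'[OF this] show ?thesis by (simp add: f_def field_simps)
  qed
  then have "(\<Sum>\<^sub>\<infinity>m\<in>{i..}. 1 / 2 ^ m :: real) = 2 / 2 ^ i"
    by (intro infsum) auto
  moreover have "(\<lambda>j. real (j + i) / 2 ^ (j + i)) sums (2 * (real i + 1) / 2 ^ i)"
  proof -
    define f :: "nat \<Rightarrow> real" where "f j = 2 * (real (j + i) + 1) / 2 ^ (j + i)" for j
    have "f \<longlonglongrightarrow> 0" unfolding f_def by real_asymp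
    moreover have "f j - f (Suc j) = real (j + i) / 2 ^ (j + i)" for j
      by (simp add: f_def field_simps)
    ultimately show ?thesis using telescope_sums'[of f 0] by (simp add: f_def)
  qed
  then have "(\<Sum>\<^sub>\<infinity>m\<in>{i..}. real m / 2 ^ m) = 2 * (real i + 1) / 2 ^ i"
    by (intro infsum) auto
  moreover have "Av_inf P i = (\<Sum>\<^sub>\<infinity>m\<in>{i..}. real m / 2 ^ m) / (\<Sum>\<^sub>\<infinity>m\<in>{i..}. 1 / 2 ^ m)"
    unfolding Av_inf_def by (intro arg_cong2[where f = "(/)"] infsum_cong) (simp_all add: assms)
  ultimately show ?thesis by simp
qed

theorem proposition4p2p5:
  fixes P :: "real measure" and n :: nat
  assumes conjecture_C:
    "\<forall>k\<ge>2. \<forall>p :: nat \<Rightarrow> real. bij_betw p {1..k-1} ((\<lambda>j. 1 / 2 ^ j) ` {1..k-1}) \<longrightarrow>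
       (\<forall>m\<ge>k+2. \<forall>a :: nat \<Rightarrow> real. strict_mono_on {1..m} a \<longrightarrow>
          optimal_n_means m (dirac_series (\<lambda>j. if j < k then p j else 1 / 2 ^ j)) (a ` {1..m}) \<longrightarrow>
          (\<forall>i\<in>{1..m-3}. a i = real i))"
    and P: "P = dirac_series (\<lambda>j. if j = 1 then 1 / 2 ^ 3 else if j = 2 then 1 / 2 ^ 2
                  else if j = 3 then 1 / 2 else 1 / 2 ^ j)"
    and n: "n \<ge> 6"
  shows "{\<alpha>. optimal_n_means n P \<alpha>} =
           {real ` {1..n-3} \<union> {Av P (n-2) (n-1), Av P n (n+1), Av_inf P (n+2)},
            real ` {1..n-2} \<union> {Av P (n-1) n, Av_inf P (n+1)}}
         \<and> quantization_error n P = ennreal (2 powi (3 - int n) / 3)"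
proof -
  define w :: "nat \<Rightarrow> real" where "w = (\<lambda>j. if j = 1 then 1 / 2 ^ 3 else if j = 2 then 1 / 2 ^ 2
                  else if j = 3 then 1 / 2 else 1 / 2 ^ j)"
  have P_w: "P = dirac_series w" by (simp add: P w_def)
  interpret permuted_geometric_weights w
  proof
    show "summable (\<lambda>j. w j * (real j - x)\<^sup>2)" for x
    proof -
      have "\<forall>\<^sub>F j in sequentially. w j * (real j - x)\<^sup>2 = (real j - x)\<^sup>2 / 2 ^ j"
        using eventually_ge_at_top[of 4] by eventually_elim (simp add: w_def)
      then show ?thesis
        using sums_geometric_square[of x] by (simp add: summable_cong sums_iff)
    qed
  qed (simp_all add: w_def)
  \<comment> \<open>The general bound at \<open>i = 1\<close> and \<open>m = n\<close>, hence
    \<open>e = n + 1\<close> in the candidates; it equals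
    \<open>2 powi (3 - int n) / 3\<close>.\<close>
  define V :: real where "V = 16 / (3 * 2 ^ (n + 1))"
  define \<alpha>\<^sub>1 where "\<alpha>\<^sub>1 = one_pair_means 1 (n + 1)"
  define \<alpha>\<^sub>2 where "\<alpha>\<^sub>2 = two_pair_means 1 (n + 1)"
  have lower: "V < tail_error w 1 \<alpha> \<or> tail_error w 1 \<alpha> = V \<and> \<alpha> \<in> {\<alpha>\<^sub>1, \<alpha>\<^sub>2}"
    if "finite \<alpha>" "1 \<le> card \<alpha>" "card \<alpha> \<le> n" for \<alpha>
    using tail_error_optimal_le[OF that n] by (simp add: V_def \<alpha>\<^sub>1_def \<alpha>\<^sub>2_def)
  have admissible: "finite \<alpha> \<and> 1 \<le> card \<alpha> \<and> card \<alpha> \<le> n" if "\<alpha> \<in> {\<alpha>\<^sub>1, \<alpha>\<^sub>2}" for \<alpha>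
  proof -
    have "card (real ` {1..<n - 1} \<union> {x, y}) \<le> n" for x y
      using card_Un_le[of "real ` {1..<n - 1}" "{x, y}"] card_image_le[of "{1..<n - 1}" real] n
        card_insert_le_m1[of 2 "{y}" x] by simp
    moreover have "card (real ` {1..<n - 2} \<union> {x, y, z}) \<le> n" for x y z
      using card_Un_le[of "real ` {1..<n - 2}" "{x, y, z}"] card_image_le[of "{1..<n - 2}" real] n
        card_insert_le_m1[of 2 "{z}" y] card_insert_le_m1[of 3 "{y, z}" x] by simp
    ultimately have "card \<alpha> \<le> n"
      using that by (auto simp: \<alpha>\<^sub>1_def \<alpha>\<^sub>2_def one_pair_means_def two_pair_means_def)
    moreover have "finite \<alpha>" "\<alpha> \<noteq> {}"
      using that by (auto simp: \<alpha>\<^sub>1_def \<alpha>\<^sub>2_def one_pair_means_def two_pair_means_def)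
    ultimately show ?thesis by (simp add: Suc_leI card_gt_0_iff)
  qed
  have "tail_error w 1 \<alpha> \<le> V" if "\<alpha> \<in> {\<alpha>\<^sub>1, \<alpha>\<^sub>2}" for \<alpha>
    using that n tail_error_one_pair_means[of 1 "n + 1"] tail_error_two_pair_means[of 1 "n + 1"]
    by (auto simp: V_def \<alpha>\<^sub>1_def \<alpha>\<^sub>2_def)
  then have attained: "tail_error w 1 \<alpha> = V" if "\<alpha> \<in> {\<alpha>\<^sub>1, \<alpha>\<^sub>2}" for \<alpha>
    using lower[of \<alpha>] admissible[OF that] that by fastforce
  have distortion: "distortion P \<alpha> = ennreal (tail_error w 1 \<alpha>)" if "finite \<alpha>" "1 \<le> card \<alpha>" for \<alpha>
    unfolding P_w using that by (intro distortion_dirac_series) auto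
  have "0 \<le> V" by (simp add: V_def)
  have quantization: "quantization_error n P = ennreal V"
  proof (rule antisym)
    have "distortion P \<alpha>\<^sub>1 = ennreal V"
      using admissible[of \<alpha>\<^sub>1] attained[of \<alpha>\<^sub>1] by (simp add: distortion)
    then show "quantization_error n P \<le> ennreal V"
      unfolding quantization_error_def using admissible[of \<alpha>\<^sub>1] by (intro INF_lower2[of \<alpha>\<^sub>1]) auto
    show "ennreal V \<le> quantization_error n P"
      unfolding quantization_error_def
    proof (rule INF_greatest)
      fix \<alpha> :: "real set" assume "\<alpha> \<in> {\<alpha>. finite \<alpha> \<and> 1 \<le> card \<alpha> \<and> card \<alpha> \<le> n}"
      then show "ennreal V \<le> distortion P \<alpha>"
        using lower[of \<alpha>] by (auto simp: distortion intro!: ennreal_leI)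
    qed
  qed
  have optimal_iff: "optimal_n_means n P \<alpha> \<longleftrightarrow> \<alpha> \<in> {\<alpha>\<^sub>1, \<alpha>\<^sub>2}" for \<alpha>
  proof
    assume "optimal_n_means n P \<alpha>"
    then have \<alpha>: "finite \<alpha>" "1 \<le> card \<alpha>" "card \<alpha> \<le> n" "ennreal (tail_error w 1 \<alpha>) = ennreal V"
      by (auto simp: optimal_n_means_def quantization distortion)
    \<comment> \<open>\<open>ennreal\<close> is injective only on nonnegative reals;
      \<open>lower\<close> gives that the error is at least \<open>V\<close>, hence
      nonnegative.\<close>
    then have "tail_error w 1 \<alpha> = V"
      using \<open>0 \<le> V\<close> lower[of \<alpha>] by (subst (asm) ennreal_inj) auto
    then show "\<alpha> \<in> {\<alpha>\<^sub>1, \<alpha>\<^sub>2}"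
      using lower[OF \<alpha>(1-3)] by simp
  next
    assume "\<alpha> \<in> {\<alpha>\<^sub>1, \<alpha>\<^sub>2}"
    then show "optimal_n_means n P \<alpha>"
      using admissible[of \<alpha>] attained[of \<alpha>] by (simp add: optimal_n_means_def quantization distortion)
  qed
  \<comment> \<open>Since \<open>n - 2 \<ge> 4\<close>, all averages in the claim avoid the permuted
    atoms.\<close>
  have mass: "measure P {real j} = 1 / 2 ^ j" if "n - 2 \<le> j" for j
    using that n by (simp add: P_w measure_dirac_series_singleton w_geometric)
  have Av: "Av P i (Suc i) = real i + 1 / 3" "Av_inf P i = real i + 1" if "n - 2 \<le> i" for i
    using that by (auto intro!: Av_geometric_pair Av_inf_geometric mass)
  have "Suc (n - 1) = n" "Suc (n - 2) = n - 1"
    using n by simp_all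
  then have "Av P (n-1) n = real n - 2 / 3" "Av_inf P (n+1) = real n + 2"
    "Av P (n-2) (n-1) = real n - 5 / 3" "Av P n (n+1) = real n + 1 / 3" "Av_inf P (n+2) = real n + 3"
    using Av(1)[of "n - 1"] Av(1)[of "n - 2"] Av(1)[of n] Av(2)[of "n + 1"] Av(2)[of "n + 2"] n
    by (simp_all add: of_nat_diff)
  moreover have "{1..<n - 1} = {1..n - 2}" "{1..<n - 2} = {1..n - 3}"
    using n by auto
  ultimately have \<alpha>_eq: "\<alpha>\<^sub>1 = real ` {1..n-2} \<union> {Av P (n-1) n, Av_inf P (n+1)}"
    "\<alpha>\<^sub>2 = real ` {1..n-3} \<union> {Av P (n-2) (n-1), Av P n (n+1), Av_inf P (n+2)}"
    by (simp_all add: \<alpha>\<^sub>1_def \<alpha>\<^sub>2_def one_pair_means_def two_pair_means_def add_ac)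
  have V_eq: "V = 2 powi (3 - int n) / 3"
    by (simp add: V_def power_int_diff)
  show ?thesis
    unfolding \<alpha>_eq[symmetric] V_eq[symmetric] using optimal_iff quantization by auto
qed

end
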